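(* Let $U_1 \neq U_2$ be points in $\mathbb{R}^2$. Let $r_1$ and $r_2$ be rotations of infinite order about $U_1$ and $U_2$ respectively. Let $\mathcal{W} := \mathcal{W}(R)$ be the peripatetic group generated by $R := \{r_1, r_2\}$. Let $P \in \mathbb{R}^2$. Then the orbit $P\mathcal{W} := \{Pf : f \in \mathcal{W}\}$ is dense in $\mathbb{R}^2$.
   Context: Isometries act on the right: $Pf$ is the image of the point $P$ under the isometry $f$. In $\mathbb{R}^2$ the axis of a rotation is its center point. A rotation $r$ has a signed radian measure $\mathrm{Rad}(r)$, taken modulo $2\pi$, positive iff counterclockwise. Peripatetic group: let $R = \{r_i : i \in F\}$ be a finite set of rotations, $r_i$ having axis $A_i$ (here $F = \{1,2\}$ and $A_i = U_i$), and let $\mathcal{G}_i := \{r_i^z : z \in \mathbb{Z}\}$ be the cyclic group generated by $r_i$. For $g_i \in \mathcal{G}_i$ and an isometry $f$ of $\mathbb{R}^2$, let $fg_i$ denote the rotation about the moved axis $A_i f$ with $\mathrm{Rad}(fg_i) = \mathrm{Rad}(g_i)$. The operation $\star$ is defined recursively by $P(f \star g_i) := (Pf)(fg_i)$ for all points $P$, that is, first apply $f$, then apply the rotation $fg_i$; and $\iota \star f = f = f \star \iota$ for the identity isometry $\iota$. The peripatetic group $\mathcal{W}(R)$ is the set of all isometries $g_{j_1} \star g_{j_2} \star \cdots \star g_{j_k}$ (evaluated from left to right, $k$ finite, each $g_{j_t} \in \mathcal{G}_{j_t}$, $j_t \in F$), with operation $\star$. *)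

theory Defs
  imports "HOL-Analysis.Analysis"
begin

text \<open>
  Isometries of the plane are functions \<open>f\<close> on \<open>real ^ 2\<close>. The action is written on the right
  in the source: the image \<open>Pf\<close> is \<open>f P\<close> here, and "first \<open>f\<close>, then \<open>h\<close>" is \<open>h \<circ> f\<close>.
\<close>

text \<open>The counterclockwise rotation about \<open>A\<close> by the signed angle \<open>\<theta>\<close>.\<close>

definition rot :: "real ^ 2 \<Rightarrow> real \<Rightarrow> real ^ 2 \<Rightarrow> real ^ 2" where
  "rot A \<theta> P =
     A + (vector [vector [cos \<theta>, - sin \<theta>], vector [sin \<theta>, cos \<theta>]] :: real ^ 2 ^ 2) *v (P - A)"

definition is_rotation_about :: "real ^ 2 \<Rightarrow> (real ^ 2 \<Rightarrow> real ^ 2) \<Rightarrow> bool" where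
  "is_rotation_about A r \<longleftrightarrow> (\<exists>\<theta>. r = rot A \<theta>)"

text \<open>
  The radian measure is taken modulo \<open>2 * pi\<close>: \<open>Rad r\<close> is the residue class, as a set of reals
  (see \<open>Rad_rot\<close>).
\<close>

definition Rad :: "(real ^ 2 \<Rightarrow> real ^ 2) \<Rightarrow> real set" where
  "Rad r = {\<theta>. \<exists>A. r = rot A \<theta>}"

text \<open>
  Unspecified for the identity, which is a rotation about every point; this is harmless, since
  a rotation of measure \<open>0\<close> about any moved axis is again the identity (see \<open>star_id_right\<close>).
\<close>

definition rotation_axis :: "(real ^ 2 \<Rightarrow> real ^ 2) \<Rightarrow> real ^ 2" where
  "rotation_axis r = (THE A. r A = A)"

definition int_power :: "('a \<Rightarrow> 'a) \<Rightarrow> int \<Rightarrow> 'a \<Rightarrow> 'a" where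
  "int_power r z = (if z \<ge> 0 then r ^^ nat z else inv r ^^ nat (- z))"

definition cyclic_group :: "('a \<Rightarrow> 'a) \<Rightarrow> ('a \<Rightarrow> 'a) set" where
  "cyclic_group r = {int_power r z |z. True}"

definition infinite_order :: "('a \<Rightarrow> 'a) \<Rightarrow> bool" where
  "infinite_order r \<longleftrightarrow> (\<forall>n::nat. n > 0 \<longrightarrow> r ^^ n \<noteq> id)"

text \<open>The rotation written \<open>fg\<close> in the source, where \<open>A\<close> is the axis of \<open>g\<close>.\<close>

definition moved_rotation ::
  "(real ^ 2 \<Rightarrow> real ^ 2) \<Rightarrow> real ^ 2 \<Rightarrow> (real ^ 2 \<Rightarrow> real ^ 2) \<Rightarrow> real ^ 2 \<Rightarrow> real ^ 2" where
  "moved_rotation f A g = (THE h. is_rotation_about (f A) h \<and> Rad h = Rad g)"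

definition star ::
  "(real ^ 2 \<Rightarrow> real ^ 2) \<Rightarrow> real ^ 2 \<Rightarrow> (real ^ 2 \<Rightarrow> real ^ 2) \<Rightarrow> real ^ 2 \<Rightarrow> real ^ 2" where
  "star f A g = moved_rotation f A g \<circ> f"

text \<open>
  A word is a list of letters \<open>(r, g)\<close> with \<open>r\<close> a generator and \<open>g\<close> in the cyclic group of \<open>r\<close>;
  the letter records \<open>r\<close> because \<open>r\<close> determines the axis. By \<open>star_id_left\<close>, starting
  the left-to-right evaluation at the identity does not change the value of a nonempty word.
\<close>

definition word_value ::
  "((real ^ 2 \<Rightarrow> real ^ 2) \<times> (real ^ 2 \<Rightarrow> real ^ 2)) list \<Rightarrow> real ^ 2 \<Rightarrow> real ^ 2" where
  "word_value w = foldl (\<lambda>f (r, g). star f (rotation_axis r) g) id w"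

definition peripatetic_group ::
  "(real ^ 2 \<Rightarrow> real ^ 2) set \<Rightarrow> (real ^ 2 \<Rightarrow> real ^ 2) set" where
  "peripatetic_group R = {word_value w |w. set w \<subseteq> Sigma R cyclic_group}"


lemma rot_1: "rot A t P $ 1 = A $ 1 + (cos t * (P $ 1 - A $ 1) - sin t * (P $ 2 - A $ 2))"
  and rot_2: "rot A t P $ 2 = A $ 2 + (sin t * (P $ 1 - A $ 1) + cos t * (P $ 2 - A $ 2))"
  by (simp_all add: rot_def matrix_vector_mult_def sum_2)

lemma rot_add: "rot A s (rot A t P) = rot A (s + t) P"
  by (simp add: vec_eq_iff forall_2 rot_1 rot_2 cos_add sin_add algebra_simps)

lemma rot_zero: "rot A 0 = id"
  by (rule ext) (simp add: vec_eq_iff forall_2 rot_1 rot_2)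

lemma rot_cong: "cos s = cos t \<Longrightarrow> sin s = sin t \<Longrightarrow> rot A s = rot A t"
  by (rule ext) (simp add: rot_def)

lemma rot_eq_imp:
  assumes "rot A s = rot B t"
  shows "cos s = cos t \<and> sin s = sin t"
proof -
  define e :: "real ^ 2" where "e = vector [1, 0]"
  have *: "rot C u e $ 1 - rot C u 0 $ 1 = cos u" "rot C u e $ 2 - rot C u 0 $ 2 = sin u" for C u
    by (simp_all add: rot_1 rot_2 e_def algebra_simps)
  show ?thesis
    using *[of A s] *[of B t] assms by simp
qed

lemma mem_Rad_rot: "s \<in> Rad (rot B t) \<longleftrightarrow> sin s = sin t \<and> cos s = cos t"
proof
  assume "s \<in> Rad (rot B t)"
  then obtain A where "rot B t = rot A s" by (auto simp: Rad_def)
  from rot_eq_imp[OF this] show "sin s = sin t \<and> cos s = cos t" by simp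
next
  assume "sin s = sin t \<and> cos s = cos t"
  then have "rot B t = rot B s" by (intro rot_cong) simp_all
  then show "s \<in> Rad (rot B t)" by (auto simp: Rad_def)
qed

lemma Rad_rot: "Rad (rot A t) = {t + 2 * pi * of_int k |k. True}"
  by (rule set_eqI) (auto simp: mem_Rad_rot sin_cos_eq_iff)

lemma moved_rotation_rot: "moved_rotation f A (rot B t) = rot (f A) t"
  unfolding moved_rotation_def
proof (rule the_equality)
  show "is_rotation_about (f A) (rot (f A) t) \<and> Rad (rot (f A) t) = Rad (rot B t)"
    by (auto simp: is_rotation_about_def Rad_rot)
next
  fix h assume h: "is_rotation_about (f A) h \<and> Rad h = Rad (rot B t)"
  then obtain s where s: "h = rot (f A) s" by (auto simp: is_rotation_about_def)
  then have "s \<in> Rad h" by (auto simp: Rad_def)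
  with h have "s \<in> Rad (rot B t)" by simp
  then show "h = rot (f A) t"
    unfolding s by (intro rot_cong) (simp_all add: mem_Rad_rot)
qed

lemma star_id_left: "is_rotation_about A g \<Longrightarrow> star id A g = g"
  by (auto simp: is_rotation_about_def star_def moved_rotation_rot)

lemma star_id_right: "star f A id = f"
  using moved_rotation_rot[of f A A 0] by (simp add: star_def rot_zero)

lemma rotation_axis_eq:
  assumes "is_rotation_about A r" "r \<noteq> id"
  shows "rotation_axis r = A"
proof -
  obtain t where r: "r = rot A t" using assms by (auto simp: is_rotation_about_def)
  have "P = A" if P: "r P = P" for P
  proof -
    define x y where "x = P $ 1 - A $ 1" and "y = P $ 2 - A $ 2"
    have e: "cos t * x - sin t * y = x" "sin t * x + cos t * y = y"
      using arg_cong[OF P, of "\<lambda>v. v $ 1"] arg_cong[OF P, of "\<lambda>v. v $ 2"]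
      by (simp_all add: r rot_1 rot_2 x_def y_def)
    have n: "cos t \<noteq> 1"
    proof
      assume "cos t = 1"
      then have "rot A t = rot A 0"
        by (intro rot_cong) (auto simp: cos_one_sin_zero)
      then show False using assms r rot_zero by simp
    qed
    have "(cos t * x - sin t * y) * x + (sin t * x + cos t * y) * y = cos t * (x\<^sup>2 + y\<^sup>2)"
      by (simp add: algebra_simps power2_eq_square)
    then have "(1 - cos t) * (x\<^sup>2 + y\<^sup>2) = 0"
      unfolding e by (simp add: left_diff_distrib power2_eq_square)
    then have "x = 0 \<and> y = 0" using n by (simp add: sum_power2_eq_zero_iff)
    then show ?thesis by (simp add: vec_eq_iff forall_2 x_def y_def)
  qed
  moreover have "r A = A" by (simp add: r rot_def)
  ultimately show ?thesis unfolding rotation_axis_def by blast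
qed

end

theory Submission
  imports Defs
begin

text \<open>
  Rotating about the moved axis \<open>f A\<close> after \<open>f\<close> is the same as rotating about \<open>A\<close> and then applying
  \<open>f\<close>, because an orientation-preserving isometry conjugates a rotation to the rotation by the same
  angle about the moved centre. Hence the operation \<open>\<star>\<close> is ordinary composition in the opposite
  order, and the peripatetic group is closed under composing a power of a generator on the left
  (\<open>peripatetic_group_comp\<close>). Consequently the orbit of \<open>P\<close> is invariant under the integer powers of
  both generators.

  A rotation of infinite order has an angle that is an irrational multiple of \<open>2 * pi\<close>, so by
  Kronecker's theorem the multiples of the angle are dense modulo \<open>2 * pi\<close>. The closure of the orbit
  is therefore invariant under every rotation about \<open>U1\<close> and every rotation about \<open>U2\<close>
  (\<open>closure_invariant_rot\<close>).

  Three rotations about \<open>U1\<close>, \<open>U2\<close>, \<open>U1\<close> whose angles add up to \<open>0\<close> compose to a translation, and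
  every vector of length at most \<open>2 * dist U1 U2\<close> arises in this way. Repeating such translations
  reaches every point of the plane from any other, so a nonempty set invariant under both families of
  rotations is the whole plane (\<open>two_centres_transitive\<close>).
\<close>

section \<open>The plane as the complex numbers\<close>

text \<open>The identification of \<open>\<complex>\<close> with the plane; it turns rotations into multiplication by \<open>cis\<close>.\<close>

definition vec_of_complex :: "complex \<Rightarrow> real ^ 2" where
  "vec_of_complex z = vector [Re z, Im z]"

lemma vec_of_complex_surj: "\<exists>z. vec_of_complex z = v"
  by (rule exI[of _ "Complex (v $ 1) (v $ 2)"])
    (simp add: vec_of_complex_def vec_eq_iff forall_2)

lemma rot_vec_of_complex:
  "rot (vec_of_complex a) t (vec_of_complex z) = vec_of_complex (a + cis t * (z - a))"
  by (simp add: vec_eq_iff forall_2 rot_1 rot_2 vec_of_complex_def)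

lemma continuous_on_rot: "continuous_on UNIV (rot A t)"
  unfolding rot_def
  by (intro continuous_intros matrix_vector_mult_linear_continuous_on[THEN continuous_on_compose2])
    auto

lemma continuous_on_rot_angle: "continuous_on UNIV (\<lambda>t. rot A t X)"
proof -
  have "continuous_on UNIV (\<lambda>t. rot A t X $ i)" for i
    using exhaust_2[of i] by (elim disjE; simp add: rot_1 rot_2; intro continuous_intros)
  then have "continuous_on UNIV (\<lambda>t. \<chi> i. rot A t X $ i)"
    by (rule continuous_on_vec_lambda)
  then show ?thesis by simp
qed

section \<open>The peripatetic group as a group of compositions\<close>

lemma rot_conj: "rot B s (rot A t P) = rot (rot B s A) t (rot B s P)"
  by (simp add: vec_eq_iff forall_2 rot_1 rot_2 algebra_simps)

lemma rot_pow: "rot A t ^^ n = rot A (real n * t)"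
proof (induction n)
  case 0
  then show ?case by (simp add: rot_zero)
next
  case (Suc n)
  then show ?case by (auto simp: fun_eq_iff rot_add algebra_simps)
qed

lemma inv_rot: "inv (rot A t) = rot A (- t)"
  by (rule inv_unique_comp) (auto simp: fun_eq_iff rot_add rot_zero)

lemma int_power_rot: "int_power (rot A t) z = rot A (of_int z * t)"
  by (simp add: int_power_def inv_rot rot_pow)

lemma star_rot_comp:
  "star (rot B s \<circ> f) A (rot C t) = rot B s \<circ> star f A (rot C t)"
  by (simp add: star_def moved_rotation_rot fun_eq_iff rot_conj[of B s "f A"])

text \<open>
  A rotation composed on the left passes through the evaluation of a word. The second
  component of a letter may be any rotation: only its angle is used, because the centre of the moved
  rotation comes from the first component.
\<close>

lemma foldl_star_comp:
  assumes "\<forall>(r, g) \<in> set w. \<exists>C t. g = rot C t"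
  shows "foldl (\<lambda>f (r, g). star f (rotation_axis r) g) (rot B s \<circ> f) w
    = rot B s \<circ> foldl (\<lambda>f (r, g). star f (rotation_axis r) g) f w"
  using assms
proof (induction w arbitrary: f)
  case Nil
  then show ?case by simp
next
  case (Cons x w)
  obtain r C t where x: "x = (r, rot C t)" using Cons.prems by (cases x) auto
  show ?case
    using Cons.IH[of "star f (rotation_axis r) (rot C t)"] Cons.prems
    by (simp add: x star_rot_comp del: o_apply)
qed

lemma peripatetic_group_comp:
  assumes R: "\<forall>r \<in> R. \<exists>C t. r = rot C t"
    and A: "rot A t \<in> R" "rot A t \<noteq> id"
    and f: "f \<in> peripatetic_group R"
  shows "rot A (of_int z * t) \<circ> f \<in> peripatetic_group R"
proof -
  let ?g = "rot A (of_int z * t)"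
  obtain w where w: "f = word_value w" "set w \<subseteq> Sigma R cyclic_group"
    using f by (auto simp: peripatetic_group_def)
  have letters: "\<forall>(r, g) \<in> set w. \<exists>C t. g = rot C t"
  proof clarify
    fix r g assume "(r, g) \<in> set w"
    then have rg: "r \<in> R" "g \<in> cyclic_group r" using w by auto
    then obtain C u where "r = rot C u" using R by blast
    then show "\<exists>C t. g = rot C t" using rg(2) by (auto simp: cyclic_group_def int_power_rot)
  qed
  have axis: "rotation_axis (rot A t) = A"
    by (rule rotation_axis_eq) (use A in \<open>auto simp: is_rotation_about_def\<close>)
  have "star id A ?g = ?g \<circ> id"
    by (simp add: star_def moved_rotation_rot)
  then have "word_value ((rot A t, ?g) # w) = ?g \<circ> f"
    using foldl_star_comp[OF letters, of A "of_int z * t" id] by (simp add: word_value_def axis w(1))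
  moreover have "?g \<in> cyclic_group (rot A t)"
    by (auto simp: cyclic_group_def int_power_rot)
  then have "set ((rot A t, ?g) # w) \<subseteq> Sigma R cyclic_group" using w(2) A(1) by auto
  ultimately show ?thesis unfolding peripatetic_group_def by (metis (mono_tags, lifting) mem_Collect_eq)
qed

lemma id_in_peripatetic_group: "id \<in> peripatetic_group R"
  unfolding peripatetic_group_def word_value_def by (auto intro!: exI[of _ "[]"])

section \<open>Density of the powers of a rotation of infinite order\<close>

lemma infinite_order_imp_irrational:
  assumes "infinite_order (rot A t)"
  shows "t / (2 * pi) \<notin> \<rat>"
proof
  assume "t / (2 * pi) \<in> \<rat>"
  then obtain i :: int and n :: nat where n: "n \<noteq> 0" and "t / (2 * pi) = of_int i / real n"
    by (auto simp: Rats_eq_int_div_nat)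
  then have "real n * t = 2 * pi * of_int i" by (simp add: field_simps)
  then have "rot A t ^^ n = rot A 0"
    unfolding rot_pow by (intro rot_cong) simp_all
  then show False using assms n by (simp add: infinite_order_def rot_zero)
qed

lemma closure_invariant_rot:
  assumes irr: "t / (2 * pi) \<notin> \<rat>"
    and inv: "\<And>X n. X \<in> S \<Longrightarrow> rot A (of_int n * t) X \<in> S"
    and X: "X \<in> closure S"
  shows "rot A u X \<in> closure S"
proof -
  have dense: "rot A u Y \<in> closure S" if Y: "Y \<in> S" for Y
  proof -
    let ?T = "{v. rot A v Y \<in> closure S}"
    have "closed ?T"
      using continuous_closed_vimage[of "closure S" "\<lambda>v. rot A v Y"] continuous_on_rot_angle[of A Y]
      by (simp add: vimage_def continuous_on_eq_continuous_at)
    moreover have "\<exists>v \<in> ?T. dist v u < e" if "e > 0" for e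
    proof -
      have "e / (2 * pi) > 0" using that by simp
      then obtain h k :: int
        where hk: "\<bar>of_int k * (t / (2 * pi)) - of_int h - u / (2 * pi)\<bar> < e / (2 * pi)"
        using sequence_of_fractional_parts_is_dense[OF irr] by metis
      define v where "v = of_int k * t - 2 * pi * of_int h"
      have "of_int k * (t / (2 * pi)) - of_int h - u / (2 * pi) = (v - u) / (2 * pi)"
        by (simp add: v_def field_simps)
      then have "dist v u < e" using hk by (simp add: dist_real_def divide_less_cancel)
      moreover have "rot A v = rot A (of_int k * t)"
        by (rule rot_cong) (simp_all add: v_def cos_diff sin_diff)
      then have "v \<in> ?T" using inv[OF Y, of k] closure_subset by auto
      ultimately show ?thesis by blast
    qed
    ultimately show ?thesis using closed_approachable[of ?T u] by blast
  qed
  have "rot A u ` closure S \<subseteq> closure S"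
    by (rule image_closure_subset) (use dense continuous_on_rot continuous_on_subset in blast)+
  then show ?thesis using X by blast
qed

section \<open>Transitivity of the rotations about two centres\<close>

text \<open>The chord from \<open>1\<close> to \<open>cis t\<close> has length \<open>2 * \<bar>sin (t / 2)\<bar>\<close>.\<close>

lemma chord_of_given_length:
  assumes "0 \<le> l" "l \<le> 2"
  obtains t where "cmod (1 - cis t) = l"
proof -
  define x where "x = arcsin (l / 2)"
  have s: "sin x = l / 2" unfolding x_def using assms by (intro sin_arcsin) auto
  have "(cmod (1 - cis (2 * x)))\<^sup>2 = (1 - cos (2 * x))\<^sup>2 + (sin (2 * x))\<^sup>2"
    by (simp add: cmod_power2)
  also have "\<dots> = 2 - 2 * cos (2 * x)"
    using sin_cos_squared_add[of "2 * x"] by (simp add: power2_eq_square algebra_simps)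
  also have "\<dots> = l\<^sup>2" by (simp add: cos_double_sin s power_divide)
  finally have "cmod (1 - cis (2 * x)) = l" using assms by simp
  then show thesis by (rule that)
qed

lemma small_translation_invariant:
  fixes a b :: complex
  assumes a: "\<And>z t. z \<in> S \<Longrightarrow> a + cis t * (z - a) \<in> S"
    and b: "\<And>z t. z \<in> S \<Longrightarrow> b + cis t * (z - b) \<in> S"
    and "a \<noteq> b" and v: "cmod v \<le> 2 * cmod (b - a)" and z: "z \<in> S"
  shows "z + v \<in> S"
proof (cases "v = 0")
  case True
  then show ?thesis using z by simp
next
  case False
  define d where "d = b - a"
  have d: "cmod d > 0" using \<open>a \<noteq> b\<close> by (simp add: d_def)
  obtain t where t: "cmod (1 - cis t) = cmod v / cmod d"
    by (rule chord_of_given_length[of "cmod v / cmod d"]) (use v d in \<open>auto simp: d_def field_simps\<close>)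
  define w where "w = (1 - cis t) * d"
  have "cmod w = cmod v" using t d by (simp add: w_def norm_mult)
  then have "cmod (v / w) = 1" using False by (simp add: norm_divide)
  then obtain u where u: "v / w = cis u"
    by (metis cis_Arg norm_zero sgn_eq div_by_1 of_real_1 zero_neq_one)
  have "w \<noteq> 0" using \<open>cmod w = cmod v\<close> False by auto
  then have v_eq: "v = cis u * w" using u by (simp add: field_simps)
  \<comment> \<open>The three angles add up to \<open>0\<close>; \<open>t\<close> fixes the length of the translation and \<open>u\<close> its direction.\<close>
  define z1 where "z1 = a + cis (- t - u) * (z - a)"
  define z2 where "z2 = b + cis t * (z1 - b)"
  have "z1 \<in> S" unfolding z1_def using z by (rule a)
  then have "z2 \<in> S" unfolding z2_def by (rule b)
  then have "a + cis u * (z2 - a) \<in> S" by (rule a)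
  moreover have "a + cis u * (z2 - a) = z + v"
  proof -
    have "cis u * (cis t * cis (- t - u)) = 1" by (simp add: cis_mult)
    moreover have "z2 - a = d + cis t * (cis (- t - u) * (z - a) - d)"
      by (simp add: z1_def z2_def d_def algebra_simps)
    then have "cis u * (z2 - a) = cis u * (cis t * cis (- t - u)) * (z - a) + v"
      unfolding v_eq w_def by (simp only:) (simp add: algebra_simps)
    ultimately show ?thesis by simp
  qed
  ultimately show ?thesis by simp
qed

lemma two_centres_transitive:
  fixes a b :: complex
  assumes a: "\<And>z t. z \<in> S \<Longrightarrow> a + cis t * (z - a) \<in> S"
    and b: "\<And>z t. z \<in> S \<Longrightarrow> b + cis t * (z - b) \<in> S"
    and "a \<noteq> b" and "S \<noteq> {}"
  shows "S = UNIV"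
proof -
  obtain z where z: "z \<in> S" using \<open>S \<noteq> {}\<close> by blast
  have "q \<in> S" for q
  proof -
    have pos: "0 < 2 * cmod (b - a)" using \<open>a \<noteq> b\<close> by simp
    obtain n :: nat where n: "cmod (q - z) < real n * (2 * cmod (b - a))"
      using ex_less_of_nat_mult[OF pos] by blast
    have n0: "n \<noteq> 0"
    proof
      assume "n = 0"
      with n have "cmod (q - z) < 0" by simp
      then show False by (simp add: not_less)
    qed
    \<comment> \<open>The segment from \<open>z\<close> to \<open>q\<close> is cut into \<open>n\<close> steps, each short enough to be an admissible translation.\<close>
    define v where "v = (q - z) / of_nat n"
    have "cmod v \<le> 2 * cmod (b - a)"
      using n n0 by (simp add: v_def norm_divide field_simps)
    then have step: "x + v \<in> S" if "x \<in> S" for x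
      using small_translation_invariant[of S a b v x] a b \<open>a \<noteq> b\<close> that by blast
    have "z + of_nat k * v \<in> S" for k
    proof (induction k)
      case 0
      then show ?case using z by simp
    next
      case (Suc k)
      then show ?case using step[OF Suc.IH] by (simp add: algebra_simps)
    qed
    from this[of n] show ?thesis using n0 by (simp add: v_def)
  qed
  then show ?thesis by blast
qed

section \<open>Density of the orbit\<close>

theorem theorem3p3:
  fixes U1 U2 P :: "real ^ 2" and r1 r2 :: "real ^ 2 \<Rightarrow> real ^ 2"
  assumes "U1 \<noteq> U2"
    and "is_rotation_about U1 r1" and "infinite_order r1"
    and "is_rotation_about U2 r2" and "infinite_order r2"
  shows "closure {f P |f. f \<in> peripatetic_group {r1, r2}} = UNIV"
proof -
  let ?R = "{r1, r2}"
  define W where "W = {f P |f. f \<in> peripatetic_group ?R}"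
  have R: "\<forall>r \<in> ?R. \<exists>C t. r = rot C t"
    using assms by (auto simp: is_rotation_about_def)
  have inv: "rot A u X \<in> closure W"
    if r: "r \<in> ?R" "is_rotation_about A r" "infinite_order r" and X: "X \<in> closure W" for A r u X
  proof -
    obtain t where t: "r = rot A t" using r(2) by (auto simp: is_rotation_about_def)
    have ne: "rot A t \<noteq> id"
      using r(3)[unfolded infinite_order_def, rule_format, of 1] by (simp add: t)
    have "rot A (of_int n * t) Y \<in> W" if Y: "Y \<in> W" for Y n
    proof -
      obtain f where "Y = f P" "f \<in> peripatetic_group ?R" using Y by (auto simp: W_def)
      then have "rot A (of_int n * t) Y = (rot A (of_int n * t) \<circ> f) P"
        "rot A (of_int n * t) \<circ> f \<in> peripatetic_group ?R"
        using peripatetic_group_comp[OF R, of A t f n] r(1) ne by (auto simp: t)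
      then show ?thesis unfolding W_def by blast
    qed
    then show ?thesis
      using closure_invariant_rot[of t W A X u] infinite_order_imp_irrational r(3) X t by blast
  qed
  obtain a b where ab: "U1 = vec_of_complex a" "U2 = vec_of_complex b"
    using vec_of_complex_surj by metis
  define S where "S = {z. vec_of_complex z \<in> closure W}"
  have "S = UNIV"
  proof (rule two_centres_transitive)
    show "a + cis t * (z - a) \<in> S" if "z \<in> S" for z t
      using inv[of r1 U1 "vec_of_complex z" t] assms that by (simp add: S_def ab rot_vec_of_complex)
    show "b + cis t * (z - b) \<in> S" if "z \<in> S" for z t
      using inv[of r2 U2 "vec_of_complex z" t] assms that by (simp add: S_def ab rot_vec_of_complex)
    show "a \<noteq> b" using \<open>U1 \<noteq> U2\<close> ab by auto
    have "P \<in> W" unfolding W_def using id_in_peripatetic_group[of ?R] by (auto intro!: exI[of _ id])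
    then show "S \<noteq> {}" using vec_of_complex_surj[of P] closure_subset by (auto simp: S_def)
  qed
  then have "v \<in> closure W" for v
    using vec_of_complex_surj[of v] by (auto simp: S_def)
  then show ?thesis by (auto simp: W_def)
qed

end
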